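(* Let $G$ be a finite simple connected triangle-free graph that contains a cycle. Then $$\operatorname{t}(G)\ \ge\ \Delta(G)+\operatorname{g}(G)-3 .$$ Moreover, equality holds for every cycle $C_g$ with $g\ge 4$ and for every complete bipartite graph $K_{a,b}$ with $a,b\ge 2$.
   Context: For a finite simple graph $G$: $\operatorname{t}(G)$ is the maximum of $|S|$ over vertex sets $S\subseteq V(G)$ such that the induced subgraph $G[S]$ is a tree (connected and acyclic); $\operatorname{g}(G)$ is the girth, i.e. the minimum length of a cycle of $G$; $\Delta(G)$ is the maximum degree. *)

theory Defs
  imports "Graph_Theory.Graph_Theory"
begin

text \<open>
  A finite simple graph is a digraph satisfying the locale predicate \<^const>\<open>graph\<close>: finite,
  symmetric, without loops and without parallel arcs. Each undirected edge is represented by its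
  two opposite arcs.

  In such a digraph the closed walk \<open>u, v, u\<close> satisfies \<^const>\<open>pre_digraph.cycle\<close>. Undirected
  cycles are therefore required to have length at least 3, and the library predicates
  \<^const>\<open>forest\<close> and \<^const>\<open>tree\<close>, which also forbid cycles of length 2, are not used.
\<close>

definition ucycle :: "('a, 'b) pre_digraph \<Rightarrow> 'b awalk \<Rightarrow> bool" where
  "ucycle G p \<equiv> pre_digraph.cycle G p \<and> 3 \<le> length p"

definition utree :: "('a, 'b) pre_digraph \<Rightarrow> bool" where
  "utree G \<equiv> Digraph_Component.connected G \<and> \<not> (\<exists>p. ucycle G p)"

definition tree_number :: "('a, 'b) pre_digraph \<Rightarrow> nat" where
  "tree_number G \<equiv> Max {card S | S. S \<subseteq> verts G \<and> utree (G \<restriction> S)}"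

text \<open>Only meaningful for graphs that contain a cycle.\<close>

definition girth :: "('a, 'b) pre_digraph \<Rightarrow> nat" where
  "girth G \<equiv> LEAST n. \<exists>p. ucycle G p \<and> length p = n"

text \<open>By symmetry and the absence of parallel arcs, the out-degree is the undirected degree.\<close>

definition max_degree :: "('a, 'b) pre_digraph \<Rightarrow> nat" where
  "max_degree G \<equiv> Max (out_degree G ` verts G)"

text \<open>The three vertices are automatically distinct, since graphs have no loops.\<close>

definition triangle_free :: "('a, 'b) pre_digraph \<Rightarrow> bool" where
  "triangle_free G \<equiv> \<not> (\<exists>u v w. u \<rightarrow>\<^bsub>G\<^esub> v \<and> v \<rightarrow>\<^bsub>G\<^esub> w \<and> w \<rightarrow>\<^bsub>G\<^esub> u)"

text \<open>
  The cycle \<open>C\<^sub>n\<close>, as a property up to isomorphism like the library's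
  \<^const>\<open>complete_bipartite_digraph\<close>: \<open>vs\<close> lists the vertices in cyclic order.
\<close>

definition cycle_graph :: "nat \<Rightarrow> ('a, 'b) pre_digraph \<Rightarrow> bool" where
  "cycle_graph n G \<equiv> graph G \<and> 3 \<le> n \<and>
     (\<exists>vs. distinct vs \<and> length vs = n \<and> verts G = set vs \<and>
        arcs_ends G = (\<Union>i<n. {(vs ! i, vs ! (Suc i mod n)), (vs ! (Suc i mod n), vs ! i)}))"

end

theory Submission
  imports Defs
begin

text \<open>
  Since the graph is triangle-free, a vertex of maximum degree together with its neighbours induces
  a star: a tree with \<open>\<Delta> + 1\<close> vertices and diameter at most 2. An outside vertex with two neighbours
  in an induced tree of diameter \<open>d\<close> closes a cycle of length at most \<open>d + 2\<close>. So while \<open>d + 2\<close> is less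
  than the girth \<open>g\<close>, every outside vertex adjacent to the tree is attached to it by a single edge and
  can be added as a leaf, which raises the diameter by at most 1. This can be done \<open>g - 4\<close> times; the
  tree never exhausts the graph, because the graph contains a cycle.

  In \<open>C\<^sub>g\<close> every induced tree omits a vertex. In \<open>K\<^sub>a\<^sub>,\<^sub>b\<close> it has at most one vertex on one of the two
  sides, since otherwise it contains a 4-cycle.
\<close>

section \<open>Cycles as vertex lists\<close>

text \<open>Library cycles are lists of arcs. With vertex lists over a bare edge relation,
  \<open>Restr E S\<close> can stand for the subgraph induced by \<open>S\<close>. The bound 3
  excludes running back and forth along one edge.\<close>

definition vcycle :: "('a \<times> 'a) set \<Rightarrow> 'a list \<Rightarrow> bool" where
  "vcycle E xs \<longleftrightarrow> 3 \<le> length xs \<and> distinct xs \<and>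
     (\<forall>i<length xs. (xs ! i, xs ! (Suc i mod length xs)) \<in> E)"

lemma vcycle_mono: "vcycle E xs \<Longrightarrow> E \<subseteq> F \<Longrightarrow> vcycle F xs"
  by (auto simp: vcycle_def)

lemma vcycle_Restr: "vcycle E xs \<Longrightarrow> set xs \<subseteq> S \<Longrightarrow> vcycle (Restr E S) xs"
  by (auto simp: vcycle_def intro!: nth_mem[THEN subsetD[rotated]] mod_less_divisor)

lemma vcycle_Restr_subset:
  assumes "vcycle (Restr E S) xs"
  shows "set xs \<subseteq> S"
  using assms by (auto simp: vcycle_def in_set_conv_nth)

text \<open>The cyclic predecessor and successor of \<open>x\<close> serve as the two neighbours.
  This is the tool for proving acyclicity: a vertex with only one neighbour lies on no
  cycle.\<close>

lemma vcycle_two_neighbours: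
  assumes "vcycle E xs" "sym E" "x \<in> set xs"
  obtains y z where "y \<in> set xs - {x}" "z \<in> set xs - {x}" "y \<noteq> z" "(x, y) \<in> E" "(x, z) \<in> E"
proof -
  define n where "n = length xs"
  have n: "3 \<le> n" and dist: "distinct xs"
    and edge: "\<And>i. i < n \<Longrightarrow> (xs ! i, xs ! (Suc i mod n)) \<in> E"
    using assms(1) by (auto simp: vcycle_def n_def)
  obtain i where i: "i < n" "x = xs ! i"
    using assms(3) by (auto simp: in_set_conv_nth n_def)
  \<comment> \<open>Cyclic predecessor of \<open>i\<close>, wrapping around at 0; \<open>k\<close>
    is the cyclic successor.\<close>
  define j where "j = (if i = 0 then n - 1 else i - 1)"
  define k where "k = Suc i mod n"
  \<comment> \<open>Here the length bound enters: for \<open>n = 2\<close> predecessor and successor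
    would coincide.\<close>
  have j: "j < n" "Suc j mod n = i" "j \<noteq> i" and k: "k < n" "k \<noteq> i" "j \<noteq> k"
    using i n by (auto simp: j_def k_def mod_Suc)
  have "(x, xs ! k) \<in> E" using edge[of i] i by (simp add: k_def)
  moreover have "(x, xs ! j) \<in> E"
    using edge[of j] j i assms(2) by (auto dest: symD)
  moreover have "xs ! k \<noteq> xs ! j" "xs ! k \<noteq> x" "xs ! j \<noteq> x"
    using i j k dist by (simp_all add: nth_eq_iff_index_eq n_def)
  ultimately show ?thesis
    using j k by (intro that[of "xs ! k" "xs ! j"]) (auto simp: n_def)
qed

section \<open>Closing a cycle through an outside vertex\<close>

text \<open>Detours can be cut out of a walk, so \<open>k\<close> steps yield a path with at most
  \<open>k + 1\<close> vertices.\<close>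

lemma relpow_distinct_walk:
  assumes "(y, z) \<in> Restr E S ^^ k" "y \<in> S"
  obtains ys where "ys \<noteq> []" "hd ys = y" "last ys = z" "distinct ys" "length ys \<le> Suc k"
    "set ys \<subseteq> S" "successively (\<lambda>a b. (a, b) \<in> E) ys"
proof -
  have "\<exists>ys. ys \<noteq> [] \<and> hd ys = y \<and> last ys = z \<and> distinct ys \<and> length ys \<le> Suc k \<and>
      set ys \<subseteq> S \<and> successively (\<lambda>a b. (a, b) \<in> E) ys"
    using assms(1)
  proof (induction k arbitrary: z)
    case 0
    then show ?case using assms(2) by (intro exI[of _ "[y]"]) auto
  next
    case (Suc k)
    then obtain w where w: "(y, w) \<in> Restr E S ^^ k" "(w, z) \<in> E" "z \<in> S"
      by auto
    from Suc.IH[OF w(1)] obtain ys where ys: "ys \<noteq> []" "hd ys = y" "last ys = w" "distinct ys"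
      "length ys \<le> Suc k" "set ys \<subseteq> S" "successively (\<lambda>a b. (a, b) \<in> E) ys"
      by blast
    show ?case
    proof (cases "z \<in> set ys")
      case True
      \<comment> \<open>The walk returns to \<open>z\<close>; cutting the path off at its earlier
        visit to \<open>z\<close> keeps it distinct and no longer than before.\<close>
      then obtain as bs where "ys = as @ z # bs" by (auto simp: in_set_conv_decomp)
      then have "ys = (as @ [z]) @ bs" by simp
      with ys show ?thesis
        by (intro exI[of _ "as @ [z]"]) (auto simp: successively_append_iff hd_append)
    next
      case False
      with ys w show ?thesis
        by (intro exI[of _ "ys @ [z]"]) (auto simp: successively_append_iff)
    qed
  qed
  then show ?thesis using that by blast
qed

text \<open>A path from \<open>y\<close> to \<open>z\<close> inside \<open>S\<close> has at most
  \<open>k + 1\<close> vertices, and \<open>x\<close>, lying outside \<open>S\<close>, closes it to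
  a cycle.\<close>

lemma vcycle_through_outside_vertex:
  assumes "sym E" "x \<notin> S" "y \<in> S" "y \<noteq> z" "(x, y) \<in> E" "(x, z) \<in> E"
    and "(y, z) \<in> Restr E S ^^ k"
  obtains xs where "vcycle E xs" "length xs \<le> k + 2"
proof -
  obtain ys where ys: "ys \<noteq> []" "hd ys = y" "last ys = z" "distinct ys" "length ys \<le> Suc k"
    "set ys \<subseteq> S" "successively (\<lambda>a b. (a, b) \<in> E) ys"
    using relpow_distinct_walk[OF assms(7,3)] .
  \<comment> \<open>Since \<open>y \<noteq> z\<close>, the path has at least two vertices, hence the
    cycle at least three.\<close>
  have len: "2 \<le> length ys"
    using ys(1-3) \<open>y \<noteq> z\<close> by (cases ys; cases "tl ys") auto
  have "((x # ys) ! i, (x # ys) ! (Suc i mod Suc (length ys))) \<in> E" if i: "i < Suc (length ys)" for i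
  proof (cases i)
    case 0
    with ys assms len show ?thesis by (simp add: hd_conv_nth)
  next
    case (Suc j)
    show ?thesis
    proof (cases "Suc j = length ys")
      case True
      with Suc ys have "ys ! j = z" by (metis diff_Suc_1 last_conv_nth)
      with True[symmetric] Suc assms(1,6) show ?thesis by (auto dest: symD)
    next
      case False
      with Suc i have "Suc j < length ys" by simp
      then have "(ys ! j, ys ! Suc j) \<in> E"
        using ys(7) by (auto simp: successively_conv_nth)
      with Suc \<open>Suc j < length ys\<close> show ?thesis by simp
    qed
  qed
  then have "vcycle E (x # ys)"
    using ys assms(2) len by (auto simp: vcycle_def)
  with ys(5) show ?thesis by (intro that[of "x # ys"]) auto
qed

section \<open>Induced trees of bounded diameter\<close>

text \<open>\<open>S\<close> induces a tree of diameter at most \<open>d\<close>. Relation powers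
  count steps, so \<open>d\<close> bounds the length of a cycle closed by an outside vertex;
  connectedness is contained in the last conjunct.\<close>

definition tree_within :: "('a \<times> 'a) set \<Rightarrow> nat \<Rightarrow> 'a set \<Rightarrow> bool" where
  "tree_within E d S \<longleftrightarrow> S \<noteq> {} \<and> (\<nexists>xs. vcycle (Restr E S) xs) \<and>
     (\<forall>u\<in>S. \<forall>v\<in>S. \<exists>k\<le>d. (u, v) \<in> Restr E S ^^ k)"

lemma tree_withinI:
  assumes "S \<noteq> {}" "\<And>xs. vcycle (Restr E S) xs \<Longrightarrow> False"
    and "\<And>u v. u \<in> S \<Longrightarrow> v \<in> S \<Longrightarrow> \<exists>k\<le>d. (u, v) \<in> Restr E S ^^ k"
  shows "tree_within E d S"
  unfolding tree_within_def using assms by meson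

lemma tree_within_walk:
  assumes "tree_within E d S" "u \<in> S" "v \<in> S"
  obtains k where "k \<le> d" "(u, v) \<in> Restr E S ^^ k"
proof -
  have "\<forall>u\<in>S. \<forall>v\<in>S. \<exists>k\<le>d. (u, v) \<in> Restr E S ^^ k"
    using assms(1) by (simp add: tree_within_def)
  from bspec[OF bspec[OF this assms(2)] assms(3)] show ?thesis
    by (elim exE conjE) (rule that)
qed

lemma relpow_mono:
  fixes R S :: "('a \<times> 'a) set"
  shows "R \<subseteq> S \<Longrightarrow> R ^^ k \<subseteq> S ^^ k"
  by (induction k) (simp_all add: relcomp_mono)

lemma relpow_sym:
  assumes "sym R" "(x, y) \<in> R ^^ k"
  shows "(y, x) \<in> R ^^ k"
  using assms(2)
proof (induction k arbitrary: y)
  case (Suc k)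
  then obtain w where "(x, w) \<in> R ^^ k" "(w, y) \<in> R" by auto
  then show ?case using Suc.IH assms(1) by (meson relpow_Suc_I2 symD)
qed auto

text \<open>\<open>x\<close> becomes a leaf attached to \<open>y\<close>. No cycle passes through a
  vertex with a single neighbour, and a walk from \<open>x\<close> takes one step more than the walk
  from \<open>y\<close>.\<close>

lemma tree_within_insert:
  assumes "sym E" "tree_within E d S" "x \<notin> S" "y \<in> S" "(x, y) \<in> E"
    and unique: "\<And>z. z \<in> S \<Longrightarrow> (x, z) \<in> E \<Longrightarrow> z = y"
  shows "tree_within E (Suc d) (insert x S)"
proof -
  let ?T = "insert x S"
  have sym_T: "sym (Restr E ?T)"
    using assms(1) by (auto simp: sym_def)
  have acyclic: False if cyc: "vcycle (Restr E ?T) xs" for xs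
  proof (cases "x \<in> set xs")
    case True
    \<comment> \<open>\<open>E\<close> is not assumed loop-free, so it matters that both neighbours
      differ from \<open>x\<close>: they then lie in \<open>S\<close>, where \<open>unique\<close>
      applies.\<close>
    then obtain a b where "a \<noteq> b" "(x, a) \<in> Restr E ?T" "(x, b) \<in> Restr E ?T" "a \<noteq> x" "b \<noteq> x"
      using vcycle_two_neighbours[OF cyc sym_T] by (metis DiffE singletonI)
    then show False using unique by blast
  next
    case False
    then have "set xs \<subseteq> S" using vcycle_Restr_subset[OF cyc] by auto
    with cyc have "vcycle (Restr E S) xs"
      by (metis vcycle_mono vcycle_Restr inf_le1)
    with assms(2) show False by (auto simp: tree_within_def)
  qed
  have dist_S: "\<exists>k\<le>d. (u, v) \<in> Restr E ?T ^^ k" if uv: "u \<in> S" "v \<in> S" for u v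
  proof -
    obtain k where k: "k \<le> d" "(u, v) \<in> Restr E S ^^ k"
      using tree_within_walk[OF assms(2) uv] .
    have "Restr E S \<subseteq> Restr E ?T" by auto
    then have "Restr E S ^^ k \<subseteq> Restr E ?T ^^ k" by (rule relpow_mono)
    with k show ?thesis by (intro exI[of _ k] conjI) (rule k(1), erule subsetD, rule k(2))
  qed
  have step: "\<exists>k\<le>Suc d. (x, v) \<in> Restr E ?T ^^ k" if "v \<in> S" for v
  proof -
    obtain k where k: "k \<le> d" "(y, v) \<in> Restr E ?T ^^ k"
      using dist_S[OF \<open>y \<in> S\<close> \<open>v \<in> S\<close>] by auto
    have "(x, y) \<in> Restr E ?T" using assms(4,5) by auto
    with k have "(x, v) \<in> Restr E ?T ^^ Suc k" by (intro relpow_Suc_I2)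
    with k(1) show ?thesis by (intro exI[of _ "Suc k"]) auto
  qed
  have dist: "\<exists>k\<le>Suc d. (u, v) \<in> Restr E ?T ^^ k" if uv: "u \<in> ?T" "v \<in> ?T" for u v
  proof -
    consider "u = x" "v = x" | "u = x" "v \<in> S" | "v = x" "u \<in> S" | "u \<in> S" "v \<in> S"
      using uv by auto
    then show ?thesis
    proof cases
      case 1
      then show ?thesis by (intro exI[of _ 0]) auto
    next
      case 2
      then show ?thesis using step by auto
    next
      case 3
      then obtain k where "k \<le> Suc d" "(v, u) \<in> Restr E ?T ^^ k" using step by auto
      then show ?thesis using relpow_sym[OF sym_T] by (intro exI[of _ k]) auto
    next
      case 4
      then show ?thesis using dist_S by (meson le_Suc_eq)
    qed
  qed
  show ?thesis by (rule tree_withinI[OF insert_not_empty acyclic dist])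
qed

text \<open>By \<open>indep\<close>, no triangle contains \<open>v\<close>. Every other vertex of
  the star then has \<open>v\<close> as its only neighbour there, which rules out cycles, and any
  two leaves are joined through \<open>v\<close>.\<close>

lemma tree_within_star:
  assumes "sym E" and indep: "\<And>a b. (v, a) \<in> E \<Longrightarrow> (v, b) \<in> E \<Longrightarrow> (a, b) \<notin> E"
  shows "tree_within E 2 (insert v (E `` {v}))"
proof -
  let ?S = "insert v (E `` {v})"
  have sym: "sym (Restr E ?S)"
    using assms(1) by (auto simp: sym_def)
  have acyclic: False if cyc: "vcycle (Restr E ?S) xs" for xs
  proof -
    have "distinct xs" "3 \<le> length xs" using cyc by (auto simp: vcycle_def)
    \<comment> \<open>Three distinct entries do not fit into \<open>{v}\<close>, so the cycle
      contains a vertex other than the hub.\<close>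
    then have "\<not> set xs \<subseteq> {v}"
      using card_mono[of "{v}" "set xs"] by (auto simp: distinct_card)
    then obtain x where x: "x \<in> set xs" "x \<noteq> v" by auto
    then have "x \<in> E `` {v}" using vcycle_Restr_subset[OF cyc] by auto
    obtain y z where "y \<noteq> z" "(x, y) \<in> Restr E ?S" "(x, z) \<in> Restr E ?S"
      using vcycle_two_neighbours[OF cyc sym x(1)] .
    moreover from this have "y = v" "z = v"
      using indep \<open>x \<in> E `` {v}\<close> by blast+
    ultimately show False by simp
  qed
  have hub: "(v, a) \<in> Restr E ?S" "(a, v) \<in> Restr E ?S" if "a \<in> E `` {v}" for a
    using that assms(1) by (auto dest: symD)
  have dist: "\<exists>k\<le>2. (a, b) \<in> Restr E ?S ^^ k" if ab: "a \<in> ?S" "b \<in> ?S" for a b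
  proof -
    consider "a = b" | "a = v" "b \<in> E `` {v}" | "b = v" "a \<in> E `` {v}"
      | "a \<in> E `` {v}" "b \<in> E `` {v}"
      using ab by auto
    then show ?thesis
    proof cases
      case 1
      then show ?thesis by (intro exI[of _ 0]) auto
    next
      case 2
      then show ?thesis using hub by (intro exI[of _ 1]) auto
    next
      case 3
      then show ?thesis using hub by (intro exI[of _ 1]) auto
    next
      case 4
      then have "(a, b) \<in> Restr E ?S O Restr E ?S" using hub by (meson relcompI)
      then show ?thesis by (intro exI[of _ 2]) (simp add: numeral_2_eq_2)
    qed
  qed
  show ?thesis by (rule tree_withinI[OF insert_not_empty acyclic dist])
qed

section \<open>Growing an induced tree\<close>

lemma rtrancl_leaves_set:
  assumes "(a, b) \<in> E\<^sup>*" "a \<in> S" "b \<notin> S"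
  shows "\<exists>y\<in>S. \<exists>x. x \<notin> S \<and> (y, x) \<in> E"
proof (rule ccontr)
  assume *: "\<not> ?thesis"
  from assms(1) have "b \<in> S"
    by induction (use assms(2) * in blast)+
  with assms(3) show False by simp
qed

text \<open>After \<open>k\<close> steps the diameter is at most \<open>d + k\<close>. The next leaf
  can be attached as long as \<open>d + k + 2 < g\<close>, where \<open>g\<close> is any lower bound
  for the cycle lengths.\<close>

lemma tree_within_grow:
  assumes "sym E" "E \<subseteq> V \<times> V" "finite V"
    and conn: "\<And>a b. a \<in> V \<Longrightarrow> b \<in> V \<Longrightarrow> (a, b) \<in> E\<^sup>*"
    and cyc: "\<exists>xs. vcycle E xs"
    and girth: "\<And>xs. vcycle E xs \<Longrightarrow> g \<le> length xs"
    and S: "S \<subseteq> V" "tree_within E d S"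
  shows "k + d + 2 \<le> g \<Longrightarrow> \<exists>T\<subseteq>V. card T = card S + k \<and> tree_within E (d + k) T"
proof (induction k)
  case 0
  then show ?case using S by (intro exI[of _ S]) simp
next
  case (Suc k)
  from Suc.prems have "k + d + 2 \<le> g" by simp
  then obtain T where T: "T \<subseteq> V" "card T = card S + k" "tree_within E (d + k) T"
    using Suc.IH by blast
  \<comment> \<open>A tree on all of \<open>V\<close> would make \<open>E\<close> itself
    acyclic.\<close>
  have "T \<noteq> V"
  proof
    assume "T = V"
    then have "Restr E T = E" using assms(2) by auto
    with T(3) cyc show False by (simp add: tree_within_def)
  qed
  then obtain b where b: "b \<in> V" "b \<notin> T" using T(1) by blast
  have "T \<noteq> {}" using T(3) by (simp add: tree_within_def)
  then obtain a where a: "a \<in> T" by blast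
  \<comment> \<open>A walk from inside \<open>T\<close> to outside must use an edge leaving
    \<open>T\<close>; its outer end \<open>x\<close> is the new leaf.\<close>
  have ab: "(a, b) \<in> E\<^sup>*" using a b T(1) by (intro conn) auto
  obtain y x where yx: "y \<in> T" "x \<notin> T" "(y, x) \<in> E"
    using rtrancl_leaves_set[OF ab a b(2)] by auto
  have xy: "(x, y) \<in> E" using yx assms(1) by (auto dest: symD)
  \<comment> \<open>A second neighbour would close a cycle of length at most
    \<open>d + k + 2\<close>, whereas \<open>Suc.prems\<close> gives
    \<open>d + k + 3 \<le> g\<close>.\<close>
  have "z = y" if z: "z \<in> T" "(x, z) \<in> E" for z
  proof (rule ccontr)
    assume "z \<noteq> y"
    obtain j where "j \<le> d + k" "(y, z) \<in> Restr E T ^^ j"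
      using tree_within_walk[OF T(3) yx(1) z(1)] .
    obtain xs where "vcycle E xs" "length xs \<le> j + 2"
      using vcycle_through_outside_vertex[OF assms(1) yx(2,1) \<open>z \<noteq> y\<close>[symmetric] xy z(2)
          \<open>(y, z) \<in> Restr E T ^^ j\<close>] .
    with girth[of xs] Suc.prems \<open>j \<le> d + k\<close> show False by auto
  qed
  then have "tree_within E (Suc (d + k)) (insert x T)"
    by (intro tree_within_insert[OF assms(1) T(3) yx(2,1) xy])
  moreover have "card (insert x T) = card S + Suc k"
    using T yx finite_subset[OF T(1) assms(3)] by auto
  moreover have "insert x T \<subseteq> V" using T yx assms(2) by auto
  ultimately show ?case by (intro exI[of _ "insert x T"]) simp
qed

lemma length_vcycle_ge_4:
  assumes "vcycle E xs" "\<And>u v w. (u, v) \<in> E \<Longrightarrow> (v, w) \<in> E \<Longrightarrow> (w, u) \<notin> E"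
  shows "4 \<le> length xs"
proof (rule ccontr)
  assume "\<not> 4 \<le> length xs"
  with assms(1) have len: "length xs = 3"
    by (simp add: vcycle_def)
  with assms(1) have *: "\<forall>i<3. (xs ! i, xs ! (Suc i mod 3)) \<in> E"
    by (simp add: vcycle_def)
  have "(xs ! 0, xs ! 1) \<in> E" "(xs ! 1, xs ! 2) \<in> E" "(xs ! 2, xs ! 0) \<in> E"
    using *[rule_format, of 0] *[rule_format, of 1] *[rule_format, of 2]
    by (simp_all add: numeral_2_eq_2)
  from assms(2)[OF this(1,2)] this(3) show False by simp
qed

section \<open>From library digraphs to edge relations\<close>

lemma arcs_ends_induce_subgraph: "arcs_ends (G \<restriction> S) = Restr (arcs_ends G) S"
  by (auto simp: arcs_ends_conv)

lemma (in graph) graph_induce_subgraph: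
  assumes "S \<subseteq> verts G"
  shows "graph (G \<restriction> S)"
proof (rule digraph.graphI)
  show "digraph (G \<restriction> S)"
    using subgraph_induce_subgraphI[OF assms] by (rule digraph_subgraph)
  show "symmetric (G \<restriction> S)"
    using sym_arcs by (auto simp: symmetric_def arcs_ends_induce_subgraph sym_def)
qed

text \<open>Library connectedness is strong connectedness of the symmetric closure, and in a
  symmetric graph this closure does not change reachability.\<close>

lemma (in graph) connected_iff:
  "Digraph_Component.connected G \<longleftrightarrow>
     verts G \<noteq> {} \<and> (\<forall>u\<in>verts G. \<forall>v\<in>verts G. (u, v) \<in> (arcs_ends G)\<^sup>*)"
  by (simp add: connected_def strongly_connected_def reachable_mk_symmetric_eq[OF sym_arcs]
      reachable_conv cong: conj_cong ball_cong)

text \<open>The heads of the arcs are the visited vertices after the start, which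
  \<open>cycle\<close> requires to be distinct. Taking heads preserves the length, as the girth
  demands.\<close>

lemma (in wf_digraph) ucycle_imp_vcycle:
  assumes "ucycle G p"
  shows "vcycle (arcs_ends G) (map (head G) p)"
proof -
  obtain u where u: "awalk u p u" "distinct (tl (awalk_verts u p))" "3 \<le> length p"
    using assms by (auto simp: ucycle_def cycle_def)
  have "p \<noteq> []" using u by auto
  have cas: "cas u p u" using u by auto
  have dist: "distinct (map (head G) p)"
    using u(2) awalk_verts_conv'[OF cas] \<open>p \<noteq> []\<close> by simp
  \<comment> \<open>The vertex sequence of the walk is read off once from tails and once from heads;
    comparing entries shows that each head is the next tail.\<close>
  have eq: "map (tail G) p @ [head G (last p)] = tail G (hd p) # map (head G) p"
    using awalk_verts_conv[of u p] awalk_verts_conv'[OF cas] \<open>p \<noteq> []\<close> by simp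
  have "tail G (hd p) = u" using cas \<open>p \<noteq> []\<close> by (simp add: cas_simp)
  moreover have "head G (last p) = u"
    using u(1) \<open>p \<noteq> []\<close> awlast_of_awalk[OF u(1)] by (simp add: awalk_verts_conv)
  \<comment> \<open>Both ends are the base point \<open>u\<close>, which settles the wrap-around
    index.\<close>
  ultimately have closed: "head G (last p) = tail G (hd p)" by simp
  have "head G (p ! i) = tail G (p ! (Suc i mod length p))" if i: "i < length p" for i
  proof (cases "Suc i = length p")
    case True
    then show ?thesis using closed \<open>p \<noteq> []\<close> by (simp add: last_conv_nth hd_conv_nth flip: True)
  next
    case False
    with i have "Suc i < length p" by simp
    with arg_cong[OF eq, of "\<lambda>xs. xs ! Suc i"] show ?thesis by (simp add: nth_append)
  qed
  moreover have "(tail G (p ! i), head G (p ! i)) \<in> arcs_ends G" if "i < length p" for i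
    using u(1) nth_mem[OF that] by (auto intro!: in_arcs_imp_in_arcs_ends elim!: awalkE)
  moreover have "Suc i mod length p < length p" for i using \<open>p \<noteq> []\<close> by simp
  ultimately show ?thesis using u(3) dist by (simp add: vcycle_def)
qed

lemma (in wf_digraph) awalk_upt:
  assumes "x 0 \<in> verts G" "\<And>i. i < n \<Longrightarrow> a i \<in> arcs G \<and> tail G (a i) = x i \<and> head G (a i) = x (Suc i)"
  shows "awalk (x 0) (map a [0..<n]) (x n)"
  using assms(2)
proof (induction n)
  case 0
  then show ?case using assms(1) by (simp add: awalk_Nil_iff)
next
  case (Suc n)
  then have "awalk (x 0) (map a [0..<n]) (x n)" by simp
  moreover have "awalk (x n) [a n] (x (Suc n))"
    using Suc.prems[of n] arc_implies_awalk[of "a n"] by auto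
  ultimately show ?case by (auto dest: awalk_appendI)
qed

text \<open>Choosing an arc for each consecutive pair turns the list into a closed walk of the same
  length, so the girth can be read off from vertex cycles.\<close>

lemma (in wf_digraph) vcycle_imp_ucycle:
  assumes "vcycle (arcs_ends G) xs"
  obtains p where "ucycle G p" "length p = length xs"
proof -
  define n where "n = length xs"
  \<comment> \<open>Periodic indexing gives \<open>x n = x 0\<close>, so the closing edge is no
    special case.\<close>
  define x where "x i = xs ! (i mod n)" for i
  have n: "3 \<le> n" "distinct xs" and edge: "\<And>i. i < n \<Longrightarrow> (x i, x (Suc i)) \<in> arcs_ends G"
    using assms by (auto simp: vcycle_def n_def x_def)
  then have "\<exists>a. i < n \<longrightarrow> a \<in> arcs G \<and> tail G a = x i \<and> head G a = x (Suc i)" for i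
    by (metis reachableE)
  then obtain a where a: "\<And>i. i < n \<Longrightarrow> a i \<in> arcs G \<and> tail G (a i) = x i \<and> head G (a i) = x (Suc i)"
    by metis
  define p where "p = map a [0..<n]"
  have "x n = x 0" by (simp add: x_def)
  moreover have "x 0 \<in> verts G" using edge[of 0] n by (auto dest: adj_in_verts)
  ultimately have walk: "awalk (x 0) p (x 0)"
    using awalk_upt[of x n a] a by (simp add: p_def)
  have "p \<noteq> []" using n by (simp add: p_def)
  then have "tl (awalk_verts (x 0) p) = map (head G) p"
    using walk by (auto simp: awalk_verts_conv')
  \<comment> \<open>The heads run from \<open>x 1\<close> to \<open>x n\<close>, which is
    \<open>xs\<close> rotated by one and therefore still distinct.\<close>
  also have "\<dots> = rotate1 xs"
    using a n by (intro nth_equalityI) (auto simp: p_def nth_rotate1 x_def n_def)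
  finally have "cycle p"
    using n walk \<open>p \<noteq> []\<close> by (auto simp: cycle_def)
  then show ?thesis using n that[of p] by (auto simp: ucycle_def p_def n_def)
qed

text \<open>Without parallel arcs, \<open>head G\<close> is injective on the arcs leaving
  \<open>v\<close>.\<close>

lemma (in graph) out_degree_eq_card: "out_degree G v = card (arcs_ends G `` {v})"
proof -
  have "bij_betw (head G) (out_arcs G v) (arcs_ends G `` {v})"
    using no_multi_arcs by (auto simp: bij_betw_def inj_on_def arc_to_ends_def arcs_ends_conv)
  then show ?thesis unfolding out_degree_def by (rule bij_betw_same_card)
qed

lemma (in graph) ex_ucycle_iff: "(\<exists>p. ucycle G p) \<longleftrightarrow> (\<exists>xs. vcycle (arcs_ends G) xs)"
  by (metis ucycle_imp_vcycle vcycle_imp_ucycle)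

lemma (in graph) utree_induce_subgraph_iff:
  assumes "S \<subseteq> verts G"
  shows "utree (G \<restriction> S) \<longleftrightarrow> S \<noteq> {} \<and>
    (\<forall>u\<in>S. \<forall>v\<in>S. (u, v) \<in> (Restr (arcs_ends G) S)\<^sup>*) \<and>
    (\<nexists>xs. vcycle (Restr (arcs_ends G) S) xs)"
proof -
  interpret S: graph "G \<restriction> S" using assms by (rule graph_induce_subgraph)
  show ?thesis
    by (simp add: utree_def S.connected_iff S.ex_ucycle_iff arcs_ends_induce_subgraph)
qed

lemma (in graph) tree_within_imp_utree:
  assumes "S \<subseteq> verts G" "tree_within (arcs_ends G) d S"
  shows "utree (G \<restriction> S)"
  using assms(2) unfolding utree_induce_subgraph_iff[OF assms(1)] tree_within_def
  by (meson relpow_imp_rtrancl)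

section \<open>Bounds for \<open>tree_number\<close>, \<open>girth\<close> and
  \<open>max_degree\<close>\<close>

lemma (in graph) finite_tree_sizes: "finite {card S | S. S \<subseteq> verts G \<and> utree (G \<restriction> S)}"
  by simp

lemma (in graph) card_le_tree_number:
  assumes "S \<subseteq> verts G" "utree (G \<restriction> S)"
  shows "card S \<le> tree_number G"
  unfolding tree_number_def using assms by (intro Max_ge finite_tree_sizes) auto

text \<open>Every induced tree is an induced forest, so a bound for forests suffices. The single
  vertex \<open>v\<close> is a tree, which makes the set under \<open>Max\<close> nonempty.\<close>

lemma (in graph) tree_number_le:
  assumes "v \<in> verts G"
    and bound: "\<And>S. S \<subseteq> verts G \<Longrightarrow> (\<nexists>xs. vcycle (Restr (arcs_ends G) S) xs) \<Longrightarrow> card S \<le> n"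
  shows "tree_number G \<le> n"
proof -
  have "Restr (arcs_ends G) {v} = {}" using adj_not_same by auto
  then have "\<nexists>xs. vcycle (Restr (arcs_ends G) {v}) xs" by (auto simp: vcycle_def intro!: exI[of _ 0])
  then have "utree (G \<restriction> {v})"
    using assms(1) by (auto simp: utree_induce_subgraph_iff)
  then have "{card S | S. S \<subseteq> verts G \<and> utree (G \<restriction> S)} \<noteq> {}"
    using assms(1) by blast
  then show ?thesis
    unfolding tree_number_def
    by (subst Max_le_iff[OF finite_tree_sizes]) (auto simp: utree_induce_subgraph_iff intro!: bound)
qed

lemma (in graph) girth_le:
  assumes "vcycle (arcs_ends G) xs"
  shows "girth G \<le> length xs"
  unfolding girth_def by (rule Least_le) (metis assms vcycle_imp_ucycle)

text \<open>Since \<open>girth\<close> is a \<open>LEAST\<close>, the cycle \<open>ys\<close> is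
  what ensures that the value is attained by some cycle.\<close>

lemma (in graph) girth_ge:
  assumes "vcycle (arcs_ends G) ys" "\<And>xs. vcycle (arcs_ends G) xs \<Longrightarrow> n \<le> length xs"
  shows "n \<le> girth G"
proof -
  have "\<exists>n p. ucycle G p \<and> length p = n"
    using assms(1) by (metis vcycle_imp_ucycle)
  then have "\<exists>p. ucycle G p \<and> length p = girth G"
    unfolding girth_def by (rule LeastI_ex)
  then show ?thesis using assms(2) ucycle_imp_vcycle by (metis length_map)
qed

lemma (in graph) out_degree_le_max_degree:
  assumes "v \<in> verts G"
  shows "card (arcs_ends G `` {v}) \<le> max_degree G"
  unfolding max_degree_def out_degree_eq_card[symmetric] using assms by simp

lemma (in graph) max_degree_attained:
  assumes "verts G \<noteq> {}"
  obtains v where "v \<in> verts G" "card (arcs_ends G `` {v}) = max_degree G"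
proof -
  have "max_degree G \<in> out_degree G ` verts G"
    unfolding max_degree_def using assms by (intro Max_in) auto
  then show ?thesis using that by (auto simp: out_degree_eq_card)
qed

section \<open>The lower bound\<close>

text \<open>The star at a vertex of maximum degree has \<open>max_degree G + 1\<close> vertices and
  diameter at most 2; growing it by \<open>girth G - 4\<close> leaves gives the stated size.\<close>

lemma (in graph) tree_number_ge:
  assumes "Digraph_Component.connected G" "triangle_free G" "vcycle (arcs_ends G) ys"
  shows "max_degree G + girth G - 3 \<le> tree_number G"
proof -
  let ?E = "arcs_ends G" and ?V = "verts G"
  have tri: "(w, u) \<notin> ?E" if "(u, v) \<in> ?E" "(v, w) \<in> ?E" for u v w
    using assms(2) that unfolding triangle_free_def by blast
  have sym: "sym ?E" using sym_arcs by (simp add: symmetric_def)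
  have E: "?E \<subseteq> ?V \<times> ?V" by (auto dest: adj_in_verts)
  have conn: "?V \<noteq> {}" "\<And>a b. a \<in> ?V \<Longrightarrow> b \<in> ?V \<Longrightarrow> (a, b) \<in> ?E\<^sup>*"
    using assms(1) by (auto simp: connected_iff)
  obtain v where v: "v \<in> ?V" "card (?E `` {v}) = max_degree G"
    using max_degree_attained[OF conn(1)] .
  define S where "S = insert v (?E `` {v})"
  have S: "S \<subseteq> ?V" using v E by (auto simp: S_def)
  have "v \<notin> ?E `` {v}" using adj_not_same by auto
  moreover have "finite (?E `` {v})" using E by (auto intro: finite_subset[OF _ finite_verts])
  ultimately have card_S: "card S = max_degree G + 1" using v by (simp add: S_def)
  have star: "tree_within ?E 2 S"
    unfolding S_def using sym by (rule tree_within_star) (rule tri, erule symD[OF sym])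
  have "4 \<le> girth G"
    by (rule girth_ge[OF assms(3)], erule length_vcycle_ge_4, rule tri)
  \<comment> \<open>The side condition \<open>k + d + 2 \<le> g\<close> of the growth lemma for
    \<open>k = girth G - 4\<close> and \<open>d = 2\<close>; the subtraction does not truncate
    because the girth is at least 4.\<close>
  then have len: "girth G - 4 + 2 + 2 \<le> girth G" by simp
  have cyc: "\<exists>xs. vcycle ?E xs" using assms(3) by (rule exI)
  obtain T where T: "T \<subseteq> ?V" "card T = card S + (girth G - 4)"
      "tree_within ?E (2 + (girth G - 4)) T"
    using tree_within_grow[OF sym E finite_verts conn(2) cyc girth_le S star len] by blast
  have "card T \<le> tree_number G"
    using T by (intro card_le_tree_number tree_within_imp_utree)
  with T card_S \<open>4 \<le> girth G\<close> show ?thesis by simp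
qed

section \<open>A criterion for equality\<close>

text \<open>The lower bound and the three estimates squeeze all invariants together, so each family
  only needs one-sided bounds.\<close>

lemma (in graph) tree_number_eq:
  assumes "Digraph_Component.connected G" "triangle_free G" "vcycle (arcs_ends G) ys"
    and upper: "tree_number G + 3 \<le> d + g" "d \<le> max_degree G"
      "\<And>xs. vcycle (arcs_ends G) xs \<Longrightarrow> g \<le> length xs"
  shows "int (tree_number G) = int (max_degree G) + int (girth G) - 3"
  using tree_number_ge[OF assms(1-3)] girth_ge[OF assms(3) upper(3)] upper(1,2) by linarith

lemma triangle_free_alt:
  "triangle_free G \<longleftrightarrow> (\<forall>u v w. (u, v) \<in> arcs_ends G \<longrightarrow> (v, w) \<in> arcs_ends G \<longrightarrow> (w, u) \<notin> arcs_ends G)"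
  by (auto simp: triangle_free_def)

section \<open>Cycle graphs\<close>

text \<open>Iterating the successor from any residue runs through all residues modulo
  \<open>n\<close>.\<close>

lemma eq_lessThan_if_closed_under_Suc_mod:
  assumes "S \<noteq> {}" "S \<subseteq> {..<n}" "\<And>i. i \<in> S \<Longrightarrow> Suc i mod n \<in> S"
  shows "S = {..<n}"
proof -
  obtain i where i: "i \<in> S" using assms(1) by auto
  have step: "(i + k) mod n \<in> S" for k
  proof (induction k)
    case 0
    then show ?case using i assms(2) by auto
  next
    case (Suc k)
    then show ?case using assms(3)[of "(i + k) mod n"] by (simp add: mod_Suc_eq)
  qed
  have "j \<in> S" if "j < n" for j
  proof -
    \<comment> \<open>From \<open>i\<close>, the first \<open>n - i\<close> steps wrap around to 0,
      and \<open>j\<close> more reach \<open>j\<close>.\<close>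
    have "(i + (n - i + j)) mod n = j" using that i assms(2) by auto
    then show ?thesis using step by metis
  qed
  then show ?thesis using assms(2) by auto
qed

text \<open>The criterion is met with \<open>d = 2\<close> and \<open>g = n\<close>, since the tree
  number is at most \<open>n - 1\<close>.\<close>

lemma cycle_graph_tree_number:
  fixes C :: "('a, 'b) pre_digraph"
  assumes "4 \<le> n" "cycle_graph n C"
  shows "int (tree_number C) = int (max_degree C) + int (girth C) - 3"
proof -
  interpret graph C using assms(2) by (simp add: cycle_graph_def)
  let ?E = "arcs_ends C" and ?V = "verts C"
  obtain vs where vs: "distinct vs" "length vs = n" "?V = set vs"
    and E: "?E = (\<Union>i<n. {(vs ! i, vs ! (Suc i mod n)), (vs ! (Suc i mod n), vs ! i)})"
    using assms(2) by (auto simp: cycle_graph_def)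
  have sym: "sym ?E" using sym_arcs by (simp add: symmetric_def)
  have n: "Suc i mod n < n" for i using assms(1) by simp
  have eq: "vs ! i = vs ! j \<longleftrightarrow> i = j" if "i < n" "j < n" for i j
    using vs that by (simp add: nth_eq_iff_index_eq)
  have adj: "(vs ! i, vs ! j) \<in> ?E \<longleftrightarrow> j = Suc i mod n \<or> i = Suc j mod n" if "i < n" "j < n" for i j
    using that n eq unfolding E by (auto; metis)
  have V: "x \<in> ?V \<longleftrightarrow> (\<exists>i<n. x = vs ! i)" for x
    using vs by (auto simp: in_set_conv_nth)
  have cyc: "vcycle ?E vs"
    using assms(1) vs n by (auto simp: vcycle_def adj)
  \<comment> \<open>Every cycle visits all vertices, so the girth is at least \<open>n\<close>: with
    each vertex it contains two of its neighbours, one of which is the successor in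
    \<open>vs\<close>.\<close>
  have long: "set xs = ?V" if xs: "vcycle ?E xs" for xs
  proof -
    have "set xs \<subseteq> ?V"
      using vcycle_two_neighbours[OF xs sym] adj_in_verts by (metis subsetI)
    define S where "S = {i. i < n \<and> vs ! i \<in> set xs}"
    have "xs \<noteq> []" using xs by (auto simp: vcycle_def)
    then have "S \<noteq> {}" using \<open>set xs \<subseteq> ?V\<close> V by (cases xs) (auto simp: S_def)
    moreover have "Suc i mod n \<in> S" if "i \<in> S" for i
    proof -
      have i: "i < n" "vs ! i \<in> set xs" using that by (auto simp: S_def)
      obtain y z where yz: "y \<in> set xs" "z \<in> set xs" "y \<noteq> z" "(vs ! i, y) \<in> ?E" "(vs ! i, z) \<in> ?E"
        using vcycle_two_neighbours[OF xs sym i(2)] by blast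
      obtain j k where jk: "j < n" "y = vs ! j" "k < n" "z = vs ! k"
        using yz \<open>set xs \<subseteq> ?V\<close> V by (meson subsetD)
      have inj: "j = k" if "Suc j mod n = Suc k mod n"
        using that jk by (auto simp: mod_Suc split: if_splits)
      have "j \<noteq> k" "j = Suc i mod n \<or> i = Suc j mod n" "k = Suc i mod n \<or> i = Suc k mod n"
        using yz jk i adj by auto
      \<comment> \<open>By \<open>inj\<close>, two different indices cannot both precede
        \<open>i\<close>, so one of them follows it.\<close>
      then have "j = Suc i mod n \<or> k = Suc i mod n" using inj by auto
      then show ?thesis using yz jk n by (auto simp: S_def)
    qed
    ultimately have "S = {..<n}" by (intro eq_lessThan_if_closed_under_Suc_mod) (auto simp: S_def)
    then show ?thesis using V \<open>set xs \<subseteq> ?V\<close> by (auto simp: S_def)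
  qed
  have len: "n \<le> length xs" if "vcycle ?E xs" for xs
    using long[OF that] card_length[of xs] vs by (simp add: distinct_card)
  have conn: "Digraph_Component.connected C"
  proof -
    have "(vs ! 0, vs ! i) \<in> ?E\<^sup>*" if "i < n" for i
      using that
    proof (induction i)
      case (Suc i)
      then show ?case using adj[of i "Suc i"] by (auto intro: rtrancl_into_rtrancl)
    qed auto
    then have "(vs ! 0, x) \<in> ?E\<^sup>*" if "x \<in> ?V" for x using that V by auto
    moreover have "sym (?E\<^sup>*)" using sym by (rule sym_rtrancl)
    ultimately show ?thesis
      using cyc vs by (auto simp: connected_iff vcycle_def dest: symD intro: rtrancl_trans)
  qed
  have tri: "triangle_free C"
  proof (rule ccontr)
    assume "\<not> triangle_free C"
    then obtain u v w where uvw: "(u, v) \<in> ?E" "(v, w) \<in> ?E" "(w, u) \<in> ?E"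
      by (auto simp: triangle_free_alt)
    \<comment> \<open>A triangle would be a cycle of length 3, shorter than
      \<open>n\<close>.\<close>
    then have "vcycle ?E [u, v, w]"
      using adj_not_same by (auto simp: vcycle_def less_Suc_eq)
    with len assms(1) show False by fastforce
  qed
  have tree: "tree_number C \<le> n - 1"
  proof (rule tree_number_le)
    show "vs ! 0 \<in> ?V" using vs assms(1) by simp
    fix S assume S: "S \<subseteq> ?V" "\<nexists>xs. vcycle (Restr ?E S) xs"
    then have "S \<noteq> ?V" using vcycle_Restr[OF cyc, of S] vs by auto
    with S have "card S < card ?V" by (intro psubset_card_mono) auto
    then show "card S \<le> n - 1" using vs by (simp add: distinct_card)
  qed
  \<comment> \<open>The two neighbours of the vertex at index 0; they are distinct because
    \<open>n\<close> is at least 4.\<close>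
  have "{vs ! 1, vs ! (n - 1)} \<subseteq> ?E `` {vs ! 0}"
    using adj[of 0 1] adj[of 0 "n - 1"] assms(1) by auto
  moreover have "finite (?E `` {vs ! 0})"
    by (rule finite_subset[OF _ finite_verts]) (auto dest: adj_in_verts)
  ultimately have "card {vs ! 1, vs ! (n - 1)} \<le> card (?E `` {vs ! 0})"
    by (intro card_mono)
  also have "\<dots> \<le> max_degree C"
    using vs assms(1) by (intro out_degree_le_max_degree) simp
  finally have deg: "2 \<le> max_degree C" using eq[of 1 "n - 1"] assms(1) by simp
  show ?thesis
    using tree assms(1) by (intro tree_number_eq[OF conn tri cyc _ deg len]) auto
qed

section \<open>Complete bipartite graphs\<close>

text \<open>The criterion is met with \<open>d = max a b\<close> and \<open>g = 4\<close>, since the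
  tree number is at most \<open>max a b + 1\<close>.\<close>

lemma complete_bipartite_tree_number:
  fixes K :: "('a, 'b) pre_digraph"
  assumes "2 \<le> a" "2 \<le> b" "complete_bipartite_digraph a b K"
  shows "int (tree_number K) = int (max_degree K) + int (girth K) - 3"
proof -
  interpret graph K using assms(3) by (simp add: complete_bipartite_digraph_def)
  let ?E = "arcs_ends K"
  obtain A B where V: "verts K = A \<union> B" "A \<inter> B = {}" and card: "card A = a" "card B = b"
    and E: "?E = A \<times> B \<union> B \<times> A"
    using assms(3) by (auto simp: complete_bipartite_digraph_def)
  have fin: "finite A" "finite B" using V finite_verts by (metis finite_Un)+
  have square: "vcycle (Restr ?E S) [x, y, x', y']"
    if "x \<in> A \<inter> S" "x' \<in> A \<inter> S" "x \<noteq> x'" "y \<in> B \<inter> S" "y' \<in> B \<inter> S" "y \<noteq> y'" for S x x' y y'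
    using that V(2) unfolding E by (auto simp: vcycle_def less_Suc_eq)
  have two: "\<exists>x y. x \<in> X \<and> y \<in> X \<and> x \<noteq> y" if "2 \<le> card X" for X :: "'a set"
  proof -
    have "finite X" using that by (intro card_ge_0_finite) simp
    then show ?thesis using that card_le_Suc0_iff_eq[of X] by force
  qed
  obtain x x' where x: "x \<in> A" "x' \<in> A" "x \<noteq> x'" using two card assms by metis
  obtain y y' where y: "y \<in> B" "y' \<in> B" "y \<noteq> y'" using two card assms by metis
  have cyc: "vcycle ?E [x, y, x', y']"
    \<comment> \<open>Taking \<open>UNIV\<close> for \<open>S\<close> removes the
      restriction.\<close>
    using square[of x UNIV x' y y'] x y by simp
  have tri: "triangle_free K" unfolding triangle_free_alt E using V(2) by auto
  have conn: "Digraph_Component.connected K"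
  proof -
    have "(u, v) \<in> ?E\<^sup>*" if "u \<in> verts K" "v \<in> verts K" for u v
    proof -
      \<comment> \<open>Vertices on opposite sides are adjacent; two on the same side have
        \<open>x\<close> or \<open>y\<close> as a common neighbour.\<close>
      have "(u, v) \<in> ?E \<or> (u, v) \<in> ?E O ?E" using that x y V(1) unfolding E by blast
      then show ?thesis by (auto intro: rtrancl_trans)
    qed
    then show ?thesis using x V by (auto simp: connected_iff)
  qed
  have tree: "tree_number K \<le> max a b + 1"
  proof (rule tree_number_le)
    show "x \<in> verts K" using x V by auto
    fix S assume S: "S \<subseteq> verts K" "\<nexists>xs. vcycle (Restr ?E S) xs"
    have "S = (A \<inter> S) \<union> (B \<inter> S)" using S V by auto
    then have "card S \<le> card (A \<inter> S) + card (B \<inter> S)" by (metis card_Un_le)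
    \<comment> \<open>Two vertices of \<open>S\<close> on each side would form a
      \<open>square\<close>.\<close>
    moreover have "card (A \<inter> S) \<le> 1 \<or> card (B \<inter> S) \<le> 1"
      using S(2) square two[of "A \<inter> S"] two[of "B \<inter> S"]
      by (metis Suc_1 not_less_eq_eq)
    moreover have "card (A \<inter> S) \<le> a" "card (B \<inter> S) \<le> b"
      using fin card by (auto intro: card_mono)
    ultimately show "card S \<le> max a b + 1" by auto
  qed
  \<comment> \<open>\<open>x\<close> has \<open>b\<close> neighbours and \<open>y\<close> has
    \<open>a\<close>, so the maximum degree is at least both.\<close>
  have "?E `` {x} = B" "?E `` {y} = A" using x y V(2) unfolding E by auto
  then have deg: "max a b \<le> max_degree K"
    using out_degree_le_max_degree[of x] out_degree_le_max_degree[of y] x y V card by auto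
  have len: "4 \<le> length xs" if "vcycle ?E xs" for xs
    using length_vcycle_ge_4[OF that] tri unfolding triangle_free_alt by blast
  show ?thesis
    using tree by (intro tree_number_eq[OF conn tri cyc _ deg len]) auto
qed

theorem theorem2p1:
  shows "(\<forall>G :: ('a, 'b) pre_digraph.
            graph G \<and> Digraph_Component.connected G \<and> triangle_free G \<and> (\<exists>p. ucycle G p) \<longrightarrow>
            int (tree_number G) \<ge> int (max_degree G) + int (girth G) - 3)
       \<and> (\<forall>(g :: nat) (C :: ('c, 'd) pre_digraph). g \<ge> 4 \<and> cycle_graph g C \<longrightarrow>
            int (tree_number C) = int (max_degree C) + int (girth C) - 3)
       \<and> (\<forall>(a :: nat) (b :: nat) (K :: ('e, 'f) pre_digraph).
            a \<ge> 2 \<and> b \<ge> 2 \<and> complete_bipartite_digraph a b K \<longrightarrow>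
            int (tree_number K) = int (max_degree K) + int (girth K) - 3)"
proof (intro conjI allI impI)
  fix G :: "('a, 'b) pre_digraph"
  assume G: "graph G \<and> Digraph_Component.connected G \<and> triangle_free G \<and> (\<exists>p. ucycle G p)"
  then interpret graph G by simp
  obtain xs where "vcycle (arcs_ends G) xs" using G ex_ucycle_iff by blast
  with G have "max_degree G + girth G - 3 \<le> tree_number G"
    using tree_number_ge by blast
  then show "int (tree_number G) \<ge> int (max_degree G) + int (girth G) - 3" by linarith
qed (auto intro: cycle_graph_tree_number complete_bipartite_tree_number)

end
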